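(* Let $(S,\top_S,\cdot)$ be a refined locality semigroup. Let $0\notin S$, let $S^0:=S\cup\{0\}$, and let $(S^0,\ast)$ be the semigroup with zero whose operation is $$x\ast y:=\begin{cases}x\cdot y, & (x,y)\in\top_S,\\ 0, & (x,y)\notin\top_S.\end{cases}$$ Then, writing $xy$ for $x\ast y$ and $xyz$ for $x\ast y\ast z$, $$xyz\neq 0\iff xy\neq0\ \text{and}\ yz\neq0\qquad\text{for all } x,y,z\in S^0.$$
   Context: A locality set is a pair $(S,\top)$ with $S$ a set and $\top\subseteq S\times S$. A refined locality semigroup is a locality set $(S,\top)$ with a partial binary operation $\top\to S$, $(a,b)\mapsto a\cdot b=ab$, such that for all $a,b,c\in S$: (i) if $(a,b)\in\top$, then $(b,c)\in\top$ if and only if $(ab,c)\in\top$; (ii) if $(b,c)\in\top$, then $(a,b)\in\top$ if and only if $(a,bc)\in\top$; (iii) if $(a,b),(b,c)\in\top$, then $(ab)c=a(bc)$. For such $S$ the operation $\ast$ on $S^0$ is associative with zero element $0$. *)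

theory Defs
  imports Main
begin

locale locality_set =
  fixes S :: "'a set" and T :: "('a \<times> 'a) set"
  assumes locality_subset: "T \<subseteq> S \<times> S"

text \<open>
  The partial operation from T to S is a total HOL function of which only the values on T
  are constrained; what it returns outside T plays no role.
\<close>

locale refined_locality_semigroup = locality_set S T
  for S :: "'a set" and T :: "('a \<times> 'a) set" +
  fixes mult :: "'a \<Rightarrow> 'a \<Rightarrow> 'a"  (infixl "\<cdot>" 70)
  assumes mult_closed: "(a, b) \<in> T \<Longrightarrow> a \<cdot> b \<in> S"
    and refined_left:
      "\<lbrakk>a \<in> S; b \<in> S; c \<in> S; (a, b) \<in> T\<rbrakk> \<Longrightarrow> (b, c) \<in> T \<longleftrightarrow> (a \<cdot> b, c) \<in> T"
    and refined_right:
      "\<lbrakk>a \<in> S; b \<in> S; c \<in> S; (b, c) \<in> T\<rbrakk> \<Longrightarrow> (a, b) \<in> T \<longleftrightarrow> (a, b \<cdot> c) \<in> T"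
    and mult_assoc:
      "\<lbrakk>a \<in> S; b \<in> S; c \<in> S; (a, b) \<in> T; (b, c) \<in> T\<rbrakk> \<Longrightarrow> (a \<cdot> b) \<cdot> c = a \<cdot> (b \<cdot> c)"

definition adjoin_zero :: "'a \<Rightarrow> 'a set \<Rightarrow> 'a set" where
  "adjoin_zero z S = S \<union> {z}"

definition zero_ext_mult ::
  "('a \<times> 'a) set \<Rightarrow> ('a \<Rightarrow> 'a \<Rightarrow> 'a) \<Rightarrow> 'a \<Rightarrow> 'a \<Rightarrow> 'a \<Rightarrow> 'a" where
  "zero_ext_mult T mult z x y = (if (x, y) \<in> T then mult x y else z)"

text \<open>
  When z is not in S, the extended operation makes \<open>adjoin_zero z S\<close> a semigroup with zero z;
  in particular a triple product does not depend on its bracketing.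
\<close>

context refined_locality_semigroup
begin

lemma zero_ext_mult_closed:
  "zero_ext_mult T mult z x y \<in> adjoin_zero z S"
  by (simp add: zero_ext_mult_def adjoin_zero_def mult_closed)

lemma zero_ext_mult_zero:
  assumes "z \<notin> S"
  shows "zero_ext_mult T mult z z x = z" and "zero_ext_mult T mult z x z = z"
  using assms locality_subset by (auto simp: zero_ext_mult_def)

lemma zero_ext_mult_assoc:
  assumes "z \<notin> S"
  shows "zero_ext_mult T mult z (zero_ext_mult T mult z x y) w
       = zero_ext_mult T mult z x (zero_ext_mult T mult z y w)"
proof -
  have no_z: "(z, c) \<notin> T" "(c, z) \<notin> T" for c
    using assms locality_subset by auto
  have in_S: "a \<in> S \<and> b \<in> S" if "(a, b) \<in> T" for a b
    using that locality_subset by auto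
  have left: "(x, y) \<in> T \<Longrightarrow> (x \<cdot> y, w) \<in> T \<longleftrightarrow> (y, w) \<in> T"
    using refined_left[of x y w] in_S by blast
  have right: "(y, w) \<in> T \<Longrightarrow> (x, y \<cdot> w) \<in> T \<longleftrightarrow> (x, y) \<in> T"
    using refined_right[of x y w] in_S by blast
  show ?thesis
    using left right mult_assoc[of x y w] in_S no_z by (auto simp: zero_ext_mult_def)
qed

end

end

theory Submission
  imports Defs
begin

text \<open>
  Since products of related elements stay in \<open>S\<close> and zero lies outside \<open>S\<close>, a product in the
  extended semigroup is nonzero exactly when its factors are related by \<open>T\<close>. The claim is thereby
  a claim about \<open>T\<close> alone. If \<open>(x, y) \<in> T\<close>, then \<open>x \<star> y\<close> is the original product, and the left
  refinement axiom says that it is related to \<open>z\<close> exactly when \<open>y\<close> is. If \<open>(x, y) \<notin> T\<close>, then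
  \<open>x \<star> y\<close> is zero and both sides fail.
\<close>

context refined_locality_semigroup
begin

lemma zero_ext_mult_nonzero_iff:
  assumes "z \<notin> S"
  shows "zero_ext_mult T mult z x y \<noteq> z \<longleftrightarrow> (x, y) \<in> T"
  using assms mult_closed by (auto simp: zero_ext_mult_def)

text \<open>
  Membership in \<open>S\<close>, which the refinement axiom asks of all three elements, comes for free:
  the hypothesis places \<open>a\<close> and \<open>b\<close> in \<open>S\<close>, and either side of the equivalence does so for \<open>c\<close>.
\<close>

lemma refined_left_of_related:
  assumes "(a, b) \<in> T"
  shows "(a \<cdot> b, c) \<in> T \<longleftrightarrow> (b, c) \<in> T"
  using assms refined_left[of a b c] locality_subset by blast

lemma zero_ext_mult_triple_nonzero_iff:
  assumes "z \<notin> S"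
  shows "zero_ext_mult T mult z (zero_ext_mult T mult z a b) c \<noteq> z \<longleftrightarrow>
    zero_ext_mult T mult z a b \<noteq> z \<and> zero_ext_mult T mult z b c \<noteq> z"
proof (cases "(a, b) \<in> T")
  case True
  then have "zero_ext_mult T mult z a b = a \<cdot> b"
    by (simp add: zero_ext_mult_def)
  with True show ?thesis
    using zero_ext_mult_nonzero_iff[OF assms] refined_left_of_related by metis
next
  case False
  then have "zero_ext_mult T mult z a b = z"
    by (simp add: zero_ext_mult_def)
  then show ?thesis
    by (simp add: zero_ext_mult_zero[OF assms])
qed

end

theorem proposition4p4:
  fixes S :: "'a set" and T :: "('a \<times> 'a) set"
    and mult :: "'a \<Rightarrow> 'a \<Rightarrow> 'a" and zero :: 'a
    and star :: "'a \<Rightarrow> 'a \<Rightarrow> 'a"  (infixl "\<star>" 70)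
  assumes "refined_locality_semigroup S T mult"
    and "zero \<notin> S"
  defines "star \<equiv> zero_ext_mult T mult zero"
  shows "\<forall>x \<in> adjoin_zero zero S. \<forall>y \<in> adjoin_zero zero S. \<forall>z \<in> adjoin_zero zero S.
    x \<star> y \<star> z \<noteq> zero \<longleftrightarrow> x \<star> y \<noteq> zero \<and> y \<star> z \<noteq> zero"
  unfolding star_def
  using refined_locality_semigroup.zero_ext_mult_triple_nonzero_iff[OF assms(1,2)] by blast

end
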